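(* Let $n\ge 1$ and let $\mathbb{M}$ be the set of monomials in $x_1,\dots,x_n$. The Thomas division, the Janet division, the Pommaret division, Division I and Division II (defined in the context) are all continuous and constructive. Moreover, all of these divisions except that of Pommaret, i.e. the Thomas division, the Janet division, Division I and Division II, are noetherian.
   Context: $\mathbb{M}=\{x_1^{d_1}\cdots x_n^{d_n}\mid d_i\in\mathbb{N}\}$ with $\mathbb{N}$ the non-negative integers; $\deg_i(u)$ is the exponent of $x_i$ in $u$; $u\mid v$ is ordinary divisibility. Involutive division. An involutive division $L$ on $\mathbb{M}$ is given if for every finite set $U\subset\mathbb{M}$ and every $u\in U$ there is given a submonoid $L(u,U)$ of $\mathbb{M}$ such that: (a) if $w\in L(u,U)$ and $v\mid w$ then $v\in L(u,U)$; (b) if $u,v\in U$ and $uL(u,U)\cap vL(v,U)\ne\emptyset$ then $u\in vL(v,U)$ or $v\in uL(u,U)$; (c) if $v\in U$ and $v\in uL(u,U)$ then $L(v,U)\subseteq L(u,U)$; (d) if $V\subseteq U$ then $L(u,U)\subseteq L(u,V)$ for all $u\in V$. Write $u\mid_L w$ ($u$ is an $L$-involutive divisor of $w$, with respect to $U$) if $w\in uL(u,U)$. The variables lying in $L(u,U)$ form the set $M_L(u,U)$ of multiplicative variables of $u$; the remaining ones form the set $NM_L(u,U)$ of non-multiplicative variables. A division may be specified by giving, for each finite $U$ and $u\in U$, the partition of the variables into $M_L(u,U)$ and $NM_L(u,U)$; then $L(u,U)$ is the submonoid of monomials in the variables of $M_L(u,U)$. The five divisions ($U$ a finite monomial set,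 $u\in U$): - Thomas: $x_i$ is multiplicative for $u$ iff $\deg_i(u)=\max\{\deg_i(v)\mid v\in U\}$. - Janet: for $1\le i\le n$ and non-negative integers $d_1,\dots,d_i$ let $[d_1,\dots,d_i]=\{u\in U\mid \deg_j(u)=d_j,\ 1\le j\le i\}$. The variable $x_1$ is multiplicative for $u$ iff $\deg_1(u)=\max\{\deg_1(v)\mid v\in U\}$; for $i>1$, $x_i$ is multiplicative for $u\in[d_1,\dots,d_{i-1}]$ iff $\deg_i(u)=\max\{\deg_i(v)\mid v\in[d_1,\dots,d_{i-1}]\}$. - Pommaret: for $u=x_1^{d_1}\cdots x_k^{d_k}$ with $d_k>0$ the variables $x_j$ with $j\ge k$ are multiplicative and the others non-multiplicative; for $u=1$ all variables are multiplicative. - Division I: $x_i$ is non-multiplicative for $u$ iff there are $v\in U$, an integer $m$ with $1\le m\le[n/2]$ (integer part), distinct variables $x_{i_1},\dots,x_{i_m}$ and exponents $d_1,\dots,d_m>0$ with $x_{i_1}^{d_1}\cdots x_{i_m}^{d_m}\,u=\mathrm{lcm}(u,v)$ and $x_i\in\{x_{i_1},\dots,x_{i_m}\}$. - Division II: for $u=x_1^{d_1}\cdots x_n^{d_n}$, $x_i$ is multiplicative iff $d_i=\max\{d_1,\dots,d_n\}$. Continuous. $L$ is continuous if for every finite $U\subset\mathbb{M}$ and every finite sequence $u_1,\dots,u_k$ of elements of $U$ such that for each $i<k$ there is $x_j\in NM_L(u_i,U)$ with $u_{i+1}\mid_L u_i\cdot x_j$, one has $u_i\ne u_j$ for $i\ne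 j$. Constructive. A continuous division $L$ is constructive if for every finite $U\subset\mathbb{M}$, $u\in U$ and $x_i\in NM_L(u,U)$ such that $u\cdot x_i$ has no involutive divisor in $U$ and such that every product $v\cdot x_j$ with $v\in U$, $x_j\in NM_L(v,U)$, $v\cdot x_j\mid u\cdot x_i$, $v\cdot x_j\neq u\cdot x_i$ lies in $\bigcup_{t\in U}tL(t,U)$, the following holds: for every $w\in\bigcup_{t\in U}tL(t,U)$ one has $u\cdot x_i\notin wL(w,U\cup\{w\})$. Noetherian. A set $\tilde U$ is $L$-involutive if $\bigcup_{u\in\tilde U}u\mathbb{M}=\bigcup_{u\in\tilde U}uL(u,\tilde U)$. An $L$-involutive set $\tilde U\supseteq U$ is an $L$-completion of $U$ if $\bigcup_{u\in U}u\mathbb{M}=\bigcup_{u\in\tilde U}uL(u,\tilde U)$. A finite set $U$ is finitely generated with respect to $L$ if it has a finite $L$-completion. $L$ is noetherian if every finite $U\subset\mathbb{M}$ is finitely generated. *)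

theory Defs
  imports "HOL-Library.Multiset"
begin

text \<open>
  Monomials in the variables \<open>x\<^sub>1, \<dots>, x\<^sub>n\<close> are elements of the free commutative monoid on
  \<open>{1..n}\<close>, that is, multisets of variable indices, written additively:
  \<open>count u i\<close> is \<open>deg\<^sub>i(u)\<close>, \<open>{#}\<close> is \<open>1\<close>, \<open>{#i#}\<close> is \<open>x\<^sub>i\<close>, \<open>u + v\<close> is the product
  \<open>u v\<close>, \<open>u \<subseteq># v\<close> is \<open>u | v\<close> and \<open>u \<union># v\<close> is \<open>lcm(u, v)\<close>.
\<close>

type_synonym monom = "nat multiset"

definition monoms :: "nat \<Rightarrow> monom set" where
  "monoms n = {u. set_mset u \<subseteq> {1..n}}"

definition submonoid :: "nat \<Rightarrow> monom set \<Rightarrow> bool" where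
  "submonoid n A \<longleftrightarrow> A \<subseteq> monoms n \<and> {#} \<in> A \<and> (\<forall>v\<in>A. \<forall>w\<in>A. v + w \<in> A)"

text \<open>
  \<open>L u U\<close> is the set \<open>L(u, U)\<close>; it is relevant only when \<open>U\<close> is a finite subset of
  \<open>monoms n\<close> and \<open>u \<in> U\<close>.
\<close>

type_synonym division = "monom \<Rightarrow> monom set \<Rightarrow> monom set"

definition inv_cone :: "division \<Rightarrow> monom set \<Rightarrow> monom \<Rightarrow> monom set" where
  "inv_cone L U u = {u + w | w. w \<in> L u U}"

definition cone :: "nat \<Rightarrow> monom \<Rightarrow> monom set" where
  "cone n u = {u + w | w. w \<in> monoms n}"

definition involutive_division :: "nat \<Rightarrow> division \<Rightarrow> bool" where
  "involutive_division n L \<longleftrightarrow>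
     (\<forall>U. finite U \<and> U \<subseteq> monoms n \<longrightarrow>
        (\<forall>u\<in>U. submonoid n (L u U)) \<and>
        (\<forall>u\<in>U. \<forall>v w. w \<in> L u U \<and> v \<subseteq># w \<longrightarrow> v \<in> L u U) \<and>
        (\<forall>u\<in>U. \<forall>v\<in>U. inv_cone L U u \<inter> inv_cone L U v \<noteq> {} \<longrightarrow>
           u \<in> inv_cone L U v \<or> v \<in> inv_cone L U u) \<and>
        (\<forall>u\<in>U. \<forall>v\<in>U. v \<in> inv_cone L U u \<longrightarrow> L v U \<subseteq> L u U) \<and>
        (\<forall>V. V \<subseteq> U \<longrightarrow> (\<forall>u\<in>V. L u U \<subseteq> L u V)))"

definition inv_divides :: "division \<Rightarrow> monom set \<Rightarrow> monom \<Rightarrow> monom \<Rightarrow> bool" where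
  "inv_divides L U u w \<longleftrightarrow> w \<in> inv_cone L U u"

definition mult_vars :: "nat \<Rightarrow> division \<Rightarrow> monom set \<Rightarrow> monom \<Rightarrow> nat set" where
  "mult_vars n L U u = {i \<in> {1..n}. {#i#} \<in> L u U}"

definition nonmult_vars :: "nat \<Rightarrow> division \<Rightarrow> monom set \<Rightarrow> monom \<Rightarrow> nat set" where
  "nonmult_vars n L U u = {1..n} - mult_vars n L U u"

text \<open>
  Continuity, constructivity and noetherianity are properties of involutive divisions, so each
  of the following predicates includes the axioms of an involutive division.
\<close>

definition continuous_division :: "nat \<Rightarrow> division \<Rightarrow> bool" where
  "continuous_division n L \<longleftrightarrow> involutive_division n L \<and>
     (\<forall>U us. finite U \<and> U \<subseteq> monoms n \<and> set us \<subseteq> U \<and>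
        (\<forall>i. Suc i < length us \<longrightarrow>
           (\<exists>j\<in>nonmult_vars n L U (us ! i). inv_divides L U (us ! Suc i) (us ! i + {#j#}))) \<longrightarrow>
        (\<forall>i<length us. \<forall>j<length us. i \<noteq> j \<longrightarrow> us ! i \<noteq> us ! j))"

definition constructive_division :: "nat \<Rightarrow> division \<Rightarrow> bool" where
  "constructive_division n L \<longleftrightarrow> continuous_division n L \<and>
     (\<forall>U u i. finite U \<and> U \<subseteq> monoms n \<and> u \<in> U \<and> i \<in> nonmult_vars n L U u \<and>
        \<not> (\<exists>t\<in>U. inv_divides L U t (u + {#i#})) \<and>
        (\<forall>v\<in>U. \<forall>j\<in>nonmult_vars n L U v.
           v + {#j#} \<subseteq># u + {#i#} \<and> v + {#j#} \<noteq> u + {#i#} \<longrightarrow>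
           v + {#j#} \<in> (\<Union>t\<in>U. inv_cone L U t)) \<longrightarrow>
        (\<forall>w\<in>(\<Union>t\<in>U. inv_cone L U t). u + {#i#} \<notin> inv_cone L (insert w U) w))"

text \<open>
  Since \<open>L u V\<close> carries meaning only for finite \<open>V\<close>, involutive sets and completions are finite.
\<close>

definition involutive_set :: "nat \<Rightarrow> division \<Rightarrow> monom set \<Rightarrow> bool" where
  "involutive_set n L V \<longleftrightarrow> finite V \<and> V \<subseteq> monoms n \<and>
     (\<Union>u\<in>V. cone n u) = (\<Union>u\<in>V. inv_cone L V u)"

definition completion_of :: "nat \<Rightarrow> division \<Rightarrow> monom set \<Rightarrow> monom set \<Rightarrow> bool" where
  "completion_of n L U V \<longleftrightarrow> involutive_set n L V \<and> U \<subseteq> V \<and>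
     (\<Union>u\<in>U. cone n u) = (\<Union>u\<in>V. inv_cone L V u)"

definition finitely_generated :: "nat \<Rightarrow> division \<Rightarrow> monom set \<Rightarrow> bool" where
  "finitely_generated n L U \<longleftrightarrow> (\<exists>V. finite V \<and> completion_of n L U V)"

definition noetherian_division :: "nat \<Rightarrow> division \<Rightarrow> bool" where
  "noetherian_division n L \<longleftrightarrow> involutive_division n L \<and>
     (\<forall>U. finite U \<and> U \<subseteq> monoms n \<longrightarrow> finitely_generated n L U)"

text \<open>
  The division for which \<open>x\<^sub>i\<close> is multiplicative for \<open>u\<close> with respect to \<open>U\<close> iff \<open>P U u i\<close>.
\<close>

definition division_by :: "nat \<Rightarrow> (monom set \<Rightarrow> monom \<Rightarrow> nat \<Rightarrow> bool) \<Rightarrow> division" where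
  "division_by n P u U = {w. set_mset w \<subseteq> {i \<in> {1..n}. P U u i}}"

definition thomas :: "nat \<Rightarrow> division" where
  "thomas n = division_by n (\<lambda>U u i. count u i = Max ((\<lambda>v. count v i) ` U))"

text \<open>
  \<open>janet_class U d i\<close> is \<open>[d\<^sub>1, \<dots>, d\<^sub>i]\<close>. For \<open>i = 0\<close> it is all of \<open>U\<close>, so the clause for
  \<open>x\<^sub>1\<close> in the Janet division is the case \<open>i = 1\<close> of the general one.
\<close>

definition janet_class :: "monom set \<Rightarrow> (nat \<Rightarrow> nat) \<Rightarrow> nat \<Rightarrow> monom set" where
  "janet_class U d i = {u \<in> U. \<forall>j\<in>{1..i}. count u j = d j}"

definition janet :: "nat \<Rightarrow> division" where
  "janet n = division_by n
     (\<lambda>U u i. count u i = Max ((\<lambda>v. count v i) ` janet_class U (count u) (i - 1)))"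

definition pommaret :: "nat \<Rightarrow> division" where
  "pommaret n = division_by n (\<lambda>U u i. u = {#} \<or> Max (set_mset u) \<le> i)"

text \<open>The index set \<open>S\<close> is \<open>{i\<^sub>1, \<dots>, i\<^sub>m}\<close>, and \<open>d j\<close> is the exponent of \<open>x\<^sub>j\<close> for \<open>j \<in> S\<close>.\<close>

definition div_I_nonmult :: "nat \<Rightarrow> monom set \<Rightarrow> monom \<Rightarrow> nat \<Rightarrow> bool" where
  "div_I_nonmult n U u i \<longleftrightarrow>
     (\<exists>v\<in>U. \<exists>m S d. 1 \<le> m \<and> m \<le> n div 2 \<and> S \<subseteq> {1..n} \<and> card S = m \<and> (\<forall>j\<in>S. d j > 0) \<and>
        (\<Sum>j\<in>S. replicate_mset (d j) j) + u = u \<union># v \<and> i \<in> S)"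

definition division_I :: "nat \<Rightarrow> division" where
  "division_I n = division_by n (\<lambda>U u i. \<not> div_I_nonmult n U u i)"

definition division_II :: "nat \<Rightarrow> division" where
  "division_II n = division_by n (\<lambda>U u i. count u i = Max (count u ` {1..n}))"

end

theory Submission
  imports Defs
begin

text \<open>
  In all five divisions \<open>L(u, U)\<close> is spanned by variables, so membership in an involutive cone is a
  condition on exponents: \<open>w \<in> u L(u, U)\<close> iff \<open>u\<close> divides \<open>w\<close> and every variable in which \<open>w\<close> exceeds
  \<open>u\<close> is multiplicative for \<open>u\<close> (\<open>inv_cone_iff\<close>). The three properties then reduce to criteria about
  multiplicative variables.

  \<^emph>\<open>Continuity.\<close> A step goes from \<open>u\<close> to an involutive divisor \<open>v\<close> of \<open>u x\<^sub>j\<close>, with \<open>x\<^sub>j\<close>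
  non-multiplicative for \<open>u\<close>. Four divisions have a strict order that increases along every step
  (\<open>continuous_if_increasing\<close>): the degree for Thomas, where \<open>v = u x\<^sub>j\<close>; the lexicographic order for
  Janet; for Pommaret the set of multiplicative variables, then the lexicographic order; for
  Division II the largest exponent, decreasing, then the degree.
  In Division I a step may lower more than half of the exponents at once, and the argument is global
  (\<open>continuous_division_I\<close>). A repetition yields a minimal nonempty set of monomials
  that can be stepped through forever. In such a set no element is an involutive divisor of another, and
  any element is reachable from any other. Take a step from an element \<open>u\<close> of largest degree to \<open>p\<close>. It
  lowers a nonempty set \<open>T\<close> of exponents and, as \<open>p\<close> is not an involutive divisor of \<open>u\<close>, raises the
  exponent of \<open>x\<^sub>j\<close> by one, where \<open>j \<notin> T\<close>. All of \<open>T\<close> is multiplicative for \<open>p\<close>, so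
  a monomial of \<open>U\<close> that exceeds \<open>p\<close> somewhere in \<open>T\<close> exceeds it in more than half of the variables. As a step raises at most one exponent, a path from \<open>p\<close>
  that begins to exceed \<open>p\<close> in \<open>T\<close> must already exceed it everywhere outside \<open>T\<close>, and later steps
  cannot go below \<open>p\<close> there again. Hence the path cannot return to \<open>u\<close>, which exceeds \<open>p\<close> in \<open>T\<close> but
  lies below it in \<open>x\<^sub>j\<close>.

  \<^emph>\<open>Constructivity.\<close> For every division but Janet's, \<open>w \<in> t L(t, U)\<close> implies
  \<open>L(w, U \<union> {w}) \<subseteq> L(t, U)\<close>, so an involutive multiple of \<open>w\<close> is one of \<open>t\<close>
  (\<open>constructive_if_nested\<close>). This fails for Janet, since inserting \<open>w\<close> can split off a new
  class; there the assumption on the smaller products is used to climb lexicographically among the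
  divisors of \<open>u x\<^sub>i\<close> in \<open>U\<close> (\<open>constructive_janet\<close>).

  \<^emph>\<open>Noetherianity.\<close> If \<open>N\<close> bounds the exponents in \<open>U\<close>, the multiples of \<open>U\<close> with exponents at most
  \<open>N\<close> form a completion: truncating a multiple at \<open>N\<close> only lowers exponents to the value \<open>N\<close>, and in
  the four divisions concerned such a variable is multiplicative
  (\<open>noetherian_if_top_multiplicative\<close>).
\<close>

section \<open>Divisions spanned by variables\<close>

definition spanned_by_vars :: "nat \<Rightarrow> division \<Rightarrow> bool" where
  "spanned_by_vars n L \<longleftrightarrow> (\<forall>u U. L u U = {w. set_mset w \<subseteq> mult_vars n L U u})"

lemma mult_vars_division_by: "mult_vars n (division_by n P) U u = {i \<in> {1..n}. P U u i}"
  by (auto simp: mult_vars_def division_by_def)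

lemma spanned_division_by: "spanned_by_vars n (division_by n P)"
  unfolding spanned_by_vars_def mult_vars_division_by by (simp add: division_by_def)

lemma mult_vars_subset: "mult_vars n L U u \<subseteq> {1..n}"
  by (auto simp: mult_vars_def)

lemma spannedD: "spanned_by_vars n L \<Longrightarrow> w \<in> L u U \<longleftrightarrow> set_mset w \<subseteq> mult_vars n L U u"
  by (simp add: spanned_by_vars_def)

lemma inv_cone_iff:
  assumes "spanned_by_vars n L"
  shows "w \<in> inv_cone L U u \<longleftrightarrow>
    u \<subseteq># w \<and> (\<forall>i. count u i < count w i \<longrightarrow> i \<in> mult_vars n L U u)"
proof
  assume "w \<in> inv_cone L U u"
  then obtain a where a: "w = u + a" "a \<in> L u U"
    by (auto simp: inv_cone_def)
  then show "u \<subseteq># w \<and> (\<forall>i. count u i < count w i \<longrightarrow> i \<in> mult_vars n L U u)"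
    using spannedD[OF assms] by auto
next
  assume *: "u \<subseteq># w \<and> (\<forall>i. count u i < count w i \<longrightarrow> i \<in> mult_vars n L U u)"
  have "w = u + (w - u)"
    using * by simp
  moreover have "w - u \<in> L u U"
    using * by (auto simp: spannedD[OF assms] in_diff_count)
  ultimately show "w \<in> inv_cone L U u"
    unfolding inv_cone_def by blast
qed

lemma count_le_if_subset: "u \<subseteq># w \<Longrightarrow> count u i \<le> count w i"
  by (simp add: mset_subset_eq_count)

lemma monoms_count: "u \<in> monoms n \<Longrightarrow> 0 < count u i \<Longrightarrow> i \<in> {1..n}"
  by (auto simp: monoms_def)

lemma count_monoms_outside: "u \<in> monoms n \<Longrightarrow> i \<notin> {1..n} \<Longrightarrow> count u i = 0"
  using monoms_count[of u n i] by (metis gr0I)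

lemma count_less_in: "count v i < count u i \<Longrightarrow> i \<in># u"
  by (metis count_eq_zero_iff not_less_zero)

lemma inv_cone_monoms:
  assumes "spanned_by_vars n L" "u \<in> monoms n" "w \<in> inv_cone L U u"
  shows "w \<in> monoms n"
proof -
  obtain a where "w = u + a" "set_mset a \<subseteq> mult_vars n L U u"
    using assms(3) spannedD[OF assms(1)] by (auto simp: inv_cone_def)
  then have "set_mset w \<subseteq> {1..n}"
    using assms(2) mult_vars_subset[of n L U u] unfolding monoms_def by force
  then show ?thesis
    by (simp add: monoms_def)
qed

text \<open>
  The cones of \<open>u\<close> and \<open>v\<close> meet iff they share \<open>lcm(u, v)\<close>, that is, iff each variable in
  which one of them exceeds the other is multiplicative for the other. If in addition one of them
  divides the other, it does so involutively; thus only incomparable \<open>u\<close> and \<open>v\<close> have to be excluded.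
\<close>

lemma involutive_divisionI:
  assumes sp: "spanned_by_vars n L"
    and disjoint: "\<And>U u v. \<lbrakk>finite U; U \<subseteq> monoms n; u \<in> U; v \<in> U;
        \<And>i. count u i < count v i \<Longrightarrow> i \<in> mult_vars n L U u;
        \<And>i. count v i < count u i \<Longrightarrow> i \<in> mult_vars n L U v;
        \<exists>i. count u i < count v i; \<exists>i. count v i < count u i\<rbrakk> \<Longrightarrow> False"
    and nested: "\<And>U u v. \<lbrakk>finite U; U \<subseteq> monoms n; u \<in> U; v \<in> U; v \<in> inv_cone L U u\<rbrakk>
        \<Longrightarrow> mult_vars n L U v \<subseteq> mult_vars n L U u"
    and filter: "\<And>U V u. \<lbrakk>finite U; U \<subseteq> monoms n; V \<subseteq> U; u \<in> V\<rbrakk>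
        \<Longrightarrow> mult_vars n L U u \<subseteq> mult_vars n L V u"
  shows "involutive_division n L"
  unfolding involutive_division_def
proof (intro allI impI conjI ballI)
  fix U assume "finite U \<and> U \<subseteq> monoms n"
  then have U: "finite U" "U \<subseteq> monoms n"
    by auto
  show "submonoid n (L u U)" if "u \<in> U" for u
    unfolding submonoid_def monoms_def
    using mult_vars_subset[of n L U u] by (auto simp: spannedD[OF sp] dest!: subsetD)
  show "v \<in> L u U" if "w \<in> L u U \<and> v \<subseteq># w" for u v w
    using that by (auto simp: spannedD[OF sp] dest: mset_subset_eqD)
  show "u \<in> inv_cone L U v \<or> v \<in> inv_cone L U u"
    if uv: "u \<in> U" "v \<in> U" and meet: "inv_cone L U u \<inter> inv_cone L U v \<noteq> {}" for u v
  proof -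
    obtain w where w: "w \<in> inv_cone L U u" "w \<in> inv_cone L U v"
      using meet by auto
    have 1: "i \<in> mult_vars n L U u" if "count u i < count v i" for i
      using w that unfolding inv_cone_iff[OF sp] by (meson count_le_if_subset less_le_trans)
    have 2: "i \<in> mult_vars n L U v" if "count v i < count u i" for i
      using w that unfolding inv_cone_iff[OF sp] by (meson count_le_if_subset less_le_trans)
    show ?thesis
      using disjoint[OF U uv 1 2] 1 2
      unfolding inv_cone_iff[OF sp] subseteq_mset_def by (meson leI)
  qed
  show "L v U \<subseteq> L u U" if "u \<in> U" "v \<in> U" "v \<in> inv_cone L U u" for u v
    using nested[OF U that] by (auto simp: spannedD[OF sp])
  show "L u U \<subseteq> L u V" if "V \<subseteq> U" "u \<in> V" for V u
    using filter[OF U that] by (auto simp: spannedD[OF sp])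
qed

lemma involutive_division_submonoid:
  assumes "involutive_division n L" "finite U" "U \<subseteq> monoms n" "u \<in> U"
  shows "submonoid n (L u U)"
  using assms(1)[unfolded involutive_division_def, THEN spec, of U] assms(2-4) by simp

lemma involutive_division_nested:
  assumes "involutive_division n L" "finite U" "U \<subseteq> monoms n" "u \<in> U" "v \<in> U"
    and "v \<in> inv_cone L U u"
  shows "L v U \<subseteq> L u U"
  using assms(1)[unfolded involutive_division_def, THEN spec, of U] assms(2-6) by simp

section \<open>Continuity\<close>

definition inv_step :: "nat \<Rightarrow> division \<Rightarrow> monom set \<Rightarrow> monom \<Rightarrow> monom \<Rightarrow> bool" where
  "inv_step n L U u v \<longleftrightarrow> (\<exists>j\<in>nonmult_vars n L U u. inv_divides L U v (u + {#j#}))"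

lemma inv_stepE:
  assumes "spanned_by_vars n L" "inv_step n L U u v"
  obtains j where "j \<in> {1..n}" "j \<notin> mult_vars n L U u"
    "\<And>i. count v i \<le> count u i + (if i = j then 1 else 0)"
    "\<And>i. count v i < count u i + (if i = j then 1 else 0) \<Longrightarrow> i \<in> mult_vars n L U v"
proof -
  obtain j where j: "j \<in> nonmult_vars n L U u" "u + {#j#} \<in> inv_cone L U v"
    using assms(2) by (auto simp: inv_step_def inv_divides_def)
  have c: "count (u + {#j#}) i = count u i + (if i = j then 1 else 0)" for i
    by auto
  show thesis
    using j that[of j] unfolding inv_cone_iff[OF assms(1)] subseteq_mset_def c nonmult_vars_def
    by auto
qed

text \<open>
  The elements of a cyclic sequence of steps form a trap. Traps in a finite \<open>U\<close> can be chosen minimal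
  under inclusion, which is how the choice of a shortest cycle enters.
\<close>

definition trap :: "nat \<Rightarrow> division \<Rightarrow> monom set \<Rightarrow> monom set \<Rightarrow> bool" where
  "trap n L U C \<longleftrightarrow> C \<noteq> {} \<and> C \<subseteq> U \<and> (\<forall>u\<in>C. \<exists>v\<in>C. inv_step n L U u v)"

lemma continuous_if_no_minimal_trap:
  assumes inv: "involutive_division n L"
    and no_trap: "\<And>U C. \<lbrakk>finite U; U \<subseteq> monoms n; trap n L U C;
        \<And>D. D \<subseteq> C \<Longrightarrow> trap n L U D \<Longrightarrow> D = C\<rbrakk> \<Longrightarrow> False"
  shows "continuous_division n L"
  unfolding continuous_division_def
proof (intro conjI inv allI impI, elim conjE)
  fix U us i j
  assume U: "finite U" "U \<subseteq> monoms n" and us: "set us \<subseteq> U"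
    and steps: "\<forall>i. Suc i < length us \<longrightarrow> (\<exists>j\<in>nonmult_vars n L U (us ! i).
      inv_divides L U (us ! Suc i) (us ! i + {#j#}))"
    and ij: "i < length us" "j < length us" "i \<noteq> j"
  have no: False if C: "trap n L U C" for C
  proof -
    have "finite {D. trap n L U D}"
      by (rule finite_subset[of _ "Pow U"]) (auto simp: trap_def U)
    then obtain D where "trap n L U D" "\<And>E. trap n L U E \<Longrightarrow> E \<subseteq> D \<Longrightarrow> E = D"
      using finite_has_minimal[of "{D. trap n L U D}"] C by (metis empty_iff mem_Collect_eq)
    then show False
      using no_trap[OF U] by blast
  qed
  (* The entries between two equal ones form a trap. *)
  have *: False if "a < b" "b < length us" "us ! a = us ! b" for a b
  proof (rule no)
    show "trap n L U ((!) us ` {a..<b})"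
      unfolding trap_def
    proof (intro conjI ballI)
      show "(!) us ` {a..<b} \<noteq> {}" "(!) us ` {a..<b} \<subseteq> U"
        using that us by auto
      fix x assume "x \<in> (!) us ` {a..<b}"
      then obtain k where k: "a \<le> k" "k < b" "x = us ! k"
        by auto
      have st: "inv_step n L U x (us ! Suc k)"
        using steps k that(2) by (auto simp: inv_step_def)
      show "\<exists>v\<in>(!) us ` {a..<b}. inv_step n L U x v"
      proof (cases "Suc k = b")
        case True
        then show ?thesis
          using st that by (intro bexI[of _ "us ! a"]) (simp, intro imageI, simp)
      next
        case False
        then show ?thesis
          using st k by (intro bexI[of _ "us ! Suc k"]) auto
      qed
    qed
  qed
  then show "us ! i \<noteq> us ! j"
    using ij by (metis linorder_neqE_nat)
qed

lemma continuous_if_increasing: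
  assumes inv: "involutive_division n L"
    and "transp r" "asymp r"
    and inc: "\<And>U u v. \<lbrakk>finite U; U \<subseteq> monoms n; u \<in> U; v \<in> U; inv_step n L U u v\<rbrakk> \<Longrightarrow> r u v"
  shows "continuous_division n L"
proof (rule continuous_if_no_minimal_trap[OF inv])
  fix U C
  assume U: "finite U" "U \<subseteq> monoms n" and C: "trap n L U C"
  have "finite C" "C \<noteq> {}" "C \<subseteq> U"
    using C U by (auto simp: trap_def intro: finite_subset)
  moreover have "asymp_on C r" "transp_on C r"
    using assms by (auto intro: asymp_on_subset transp_on_subset)
  ultimately obtain m where m: "m \<in> C" "\<forall>x\<in>C. x \<noteq> m \<longrightarrow> \<not> r m x"
    using Finite_Set.bex_max_element[of C r] by blast
  obtain v where v: "v \<in> C" "inv_step n L U m v"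
    using C m unfolding trap_def by blast
  have "r m v"
    using inc[OF U _ _ v(2)] m(1) v(1) \<open>C \<subseteq> U\<close> by blast
  then show False
    using m v \<open>asymp r\<close> by (metis asympD)
qed

text \<open>
  Involutive divisibility is transitive, so a step into \<open>q\<close> can be redirected to any involutive
  divisor \<open>p\<close> of \<open>q\<close>. If \<open>p\<close> also lies in the trap, \<open>q\<close> is dispensable.
\<close>

lemma minimal_trap_antichain:
  assumes inv: "involutive_division n L" and U: "finite U" "U \<subseteq> monoms n"
    and C: "trap n L U C" and min: "\<And>D. D \<subseteq> C \<Longrightarrow> trap n L U D \<Longrightarrow> D = C"
    and p: "p \<in> C" and q: "q \<in> C" and pq: "q \<in> inv_cone L U p"
  shows "p = q"
proof (rule ccontr)
  assume "p \<noteq> q"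
  have in_U: "p \<in> U" "q \<in> U"
    using C p q by (auto simp: trap_def)
  have redirect: "inv_step n L U x p" if xq: "inv_step n L U x q" for x
  proof -
    obtain j where j: "j \<in> nonmult_vars n L U x" "x + {#j#} \<in> inv_cone L U q"
      using xq by (auto simp: inv_step_def inv_divides_def)
    obtain a b where a: "x + {#j#} = q + a" "a \<in> L q U" and b: "q = p + b" "b \<in> L p U"
      using j(2) pq by (auto simp: inv_cone_def)
    have "L q U \<subseteq> L p U" "submonoid n (L p U)"
      using involutive_division_nested[OF inv U in_U pq]
        involutive_division_submonoid[OF inv U in_U(1)] by auto
    then have "b + a \<in> L p U"
      using a b by (auto simp: submonoid_def)
    then have "x + {#j#} \<in> inv_cone L U p"
      using a(1) b(1) by (auto simp: inv_cone_def add.assoc)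
    then show ?thesis
      using j(1) by (auto simp: inv_step_def inv_divides_def)
  qed
  have "trap n L U (C - {q})"
    unfolding trap_def
  proof (intro conjI ballI)
    show "C - {q} \<noteq> {}"
      using p \<open>p \<noteq> q\<close> by auto
    show "C - {q} \<subseteq> U"
      using C by (auto simp: trap_def)
    fix x assume "x \<in> C - {q}"
    then obtain y where y: "y \<in> C" "inv_step n L U x y"
      using C by (auto simp: trap_def)
    show "\<exists>y\<in>C - {q}. inv_step n L U x y"
    proof (cases "y = q")
      case True
      then show ?thesis
        using redirect y p \<open>p \<noteq> q\<close> by blast
    qed (use y in blast)
  qed
  then show False
    using min[of "C - {q}"] q by blast
qed

text \<open>The elements reachable from a fixed one form a trap themselves.\<close>

lemma minimal_trap_connected:
  assumes C: "trap n L U C" and min: "\<And>D. D \<subseteq> C \<Longrightarrow> trap n L U D \<Longrightarrow> D = C"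
    and p: "p \<in> C" and q: "q \<in> C"
  shows "(\<lambda>x y. y \<in> C \<and> inv_step n L U x y)\<^sup>*\<^sup>* p q"
proof -
  let ?R = "\<lambda>x y. y \<in> C \<and> inv_step n L U x y"
  let ?D = "{x \<in> C. ?R\<^sup>*\<^sup>* p x}"
  have "trap n L U ?D"
    unfolding trap_def
  proof (intro conjI ballI)
    show "?D \<noteq> {}" using p by auto
    show "?D \<subseteq> U" using C by (auto simp: trap_def)
    fix x assume x: "x \<in> ?D"
    then obtain y where "y \<in> C" "inv_step n L U x y"
      using C by (auto simp: trap_def)
    then show "\<exists>y\<in>?D. inv_step n L U x y"
      using x by (intro bexI[of _ y]) (auto intro: rtranclp.rtrancl_into_rtrancl)
  qed
  then have "?D = C"
    by (intro min) auto
  then show ?thesis using q by blast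
qed

section \<open>Constructivity\<close>

text \<open>
  If \<open>w = t s\<close> with \<open>s \<in> L(t, U)\<close> and \<open>u x\<^sub>i = w r\<close> with \<open>r \<in> L(w, U \<union> {w})\<close>, then
  nestedness puts \<open>s r\<close> into \<open>L(t, U)\<close>, and \<open>t\<close> is an involutive divisor of \<open>u x\<^sub>i\<close> in \<open>U\<close>.
\<close>

lemma constructive_if_nested:
  assumes cont: "continuous_division n L"
    and nested: "\<And>U t w. \<lbrakk>finite U; U \<subseteq> monoms n; t \<in> U; w \<in> inv_cone L U t\<rbrakk>
        \<Longrightarrow> L w (insert w U) \<subseteq> L t U"
  shows "constructive_division n L"
  unfolding constructive_division_def
proof (intro conjI cont allI impI ballI notI, elim conjE)
  fix U u i w
  assume U: "finite U" "U \<subseteq> monoms n" and no: "\<not> (\<exists>t\<in>U. inv_divides L U t (u + {#i#}))"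
    and w: "w \<in> (\<Union>t\<in>U. inv_cone L U t)"
    and ui: "u + {#i#} \<in> inv_cone L (insert w U) w"
  obtain t where t: "t \<in> U" "w \<in> inv_cone L U t"
    using w by auto
  then obtain s where s: "w = t + s" "s \<in> L t U"
    by (auto simp: inv_cone_def)
  obtain r where r: "u + {#i#} = w + r" "r \<in> L w (insert w U)"
    using ui by (auto simp: inv_cone_def)
  have "r \<in> L t U"
    using nested[OF U t] r by auto
  moreover have "submonoid n (L t U)"
    using involutive_division_submonoid[OF _ U t(1)] cont by (simp add: continuous_division_def)
  ultimately have "s + r \<in> L t U"
    using s by (auto simp: submonoid_def)
  then have "u + {#i#} \<in> inv_cone L U t"
    using r s by (auto simp: inv_cone_def add.assoc)
  then show False
    using no t by (auto simp: inv_divides_def)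
qed

section \<open>Noetherianity\<close>

lemma finite_submultisets: "finite {w. w \<subseteq># (M :: 'a multiset)}"
proof (induction M)
  case (add x M)
  have "{w. w \<subseteq># add_mset x M} \<subseteq> {w. w \<subseteq># M} \<union> add_mset x ` {w. w \<subseteq># M}"
  proof
    fix w assume w: "w \<in> {w. w \<subseteq># add_mset x M}"
    show "w \<in> {w. w \<subseteq># M} \<union> add_mset x ` {w. w \<subseteq># M}"
    proof (cases "x \<in># w")
      case True
      then have "w = add_mset x (w - {#x#})" "w - {#x#} \<subseteq># M"
        using w by (auto simp: subset_eq_diff_conv)
      then show ?thesis by blast
    next
      case False
      then have "count w y \<le> count M y" for y
        using w mset_subset_eq_count[of w "add_mset x M" y]
        by (cases "y = x") (auto simp: not_in_iff)
      then show ?thesis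
        by (simp add: subseteq_mset_def)
    qed
  qed
  then show ?case
    using add.IH by (meson finite_UnI finite_imageI finite_subset)
qed auto

text \<open>
  The completion of \<open>U\<close> is the part of the ideal generated by \<open>U\<close> that lies in a cube containing \<open>U\<close>.
  The truncation \<open>t\<close> of a monomial \<open>w\<close> of the ideal to the cube stays in the ideal, and \<open>w\<close> exceeds
  \<open>t\<close> only in variables whose exponent in \<open>t\<close> is the side length \<open>N\<close> of the cube.
\<close>

lemma noetherian_if_top_multiplicative:
  assumes inv: "involutive_division n L" and sp: "spanned_by_vars n L"
    and top: "\<And>V u i N. \<lbrakk>finite V; V \<subseteq> monoms n; u \<in> V; i \<in> {1..n}; count u i = N;
        \<And>v k. v \<in> V \<Longrightarrow> count v k \<le> N\<rbrakk> \<Longrightarrow> i \<in> mult_vars n L V u"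
  shows "noetherian_division n L"
  unfolding noetherian_division_def
proof (intro conjI inv allI impI, elim conjE)
  fix U assume U: "finite U" "U \<subseteq> monoms n"
  (* The total degree bounds every exponent; the 0 covers the case of empty U. *)
  define N where "N = Max (insert 0 (size ` U))"
  define cube where "cube = (\<Sum>i\<in>{1..n}. replicate_mset N i)"
  define I where "I = (\<Union>u\<in>U. cone n u)"
  define V where "V = {w \<in> I. w \<subseteq># cube}"
  have count_cube: "count cube i = (if i \<in> {1..n} then N else 0)" for i
    by (simp add: cube_def count_sum sum.delta)
  have I: "w \<in> I \<longleftrightarrow> w \<in> monoms n \<and> (\<exists>u\<in>U. u \<subseteq># w)" for w
  proof
    assume "w \<in> I"
    then obtain u a where "u \<in> U" "w = u + a" "a \<in> monoms n"
      by (auto simp: I_def cone_def)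
    then show "w \<in> monoms n \<and> (\<exists>u\<in>U. u \<subseteq># w)"
      using U by (auto simp: monoms_def intro!: bexI[of _ u])
  next
    assume *: "w \<in> monoms n \<and> (\<exists>u\<in>U. u \<subseteq># w)"
    then obtain u where u: "u \<in> U" "u \<subseteq># w"
      by blast
    have "w = u + (w - u)" "w - u \<in> monoms n"
      using * u by (auto simp: monoms_def dest: in_diffD)
    then show "w \<in> I"
      unfolding I_def cone_def using u by blast
  qed
  have sub: "u \<subseteq># cube" if "u \<in> U" for u
    unfolding subseteq_mset_def
  proof
    fix i
    have "count u i \<le> size u"
      by (simp add: count_le_size)
    also have "\<dots> \<le> N"
      using U that by (auto simp: N_def intro!: Max_ge)
    finally show "count u i \<le> count cube i"
      using count_monoms_outside[of u n i] U(2) that by (cases "i \<in> {1..n}") (auto simp: count_cube)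
  qed
  have finV: "finite V"
    by (rule finite_subset[OF _ finite_submultisets[of cube]]) (auto simp: V_def)
  have UV: "U \<subseteq> V"
    using U sub by (auto simp: V_def I)
  have V_monoms: "V \<subseteq> monoms n"
    by (auto simp: V_def I)
  have V_bound: "count v k \<le> N" if "v \<in> V" for v k
    using that mset_subset_eq_count[of v cube k] by (auto simp: V_def count_cube split: if_splits)
  have coneV: "(\<Union>u\<in>V. cone n u) = I"
  proof
    show "(\<Union>u\<in>V. cone n u) \<subseteq> I"
    proof
      fix w assume "w \<in> (\<Union>u\<in>V. cone n u)"
      then obtain v a where v: "v \<in> V" "w = v + a" "a \<in> monoms n"
        by (auto simp: cone_def)
      obtain u where "u \<in> U" "u \<subseteq># v"
        using v(1) by (auto simp: V_def I)
      moreover have "v \<subseteq># w" "w \<in> monoms n"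
        using v V_monoms by (auto simp: monoms_def)
      ultimately show "w \<in> I"
        unfolding I by (meson subset_mset.trans)
    qed
    show "I \<subseteq> (\<Union>u\<in>V. cone n u)"
      unfolding I_def using UV by auto
  qed
  have invV: "(\<Union>u\<in>V. inv_cone L V u) = I"
  proof
    have "inv_cone L V u \<subseteq> cone n u" for u
      using mult_vars_subset[of n L V u]
      by (force simp: inv_cone_def cone_def monoms_def spannedD[OF sp])
    then show "(\<Union>u\<in>V. inv_cone L V u) \<subseteq> I"
      using coneV by blast
    show "I \<subseteq> (\<Union>u\<in>V. inv_cone L V u)"
    proof
      fix w assume w: "w \<in> I"
      let ?t = "w \<inter># cube"
      have t: "?t \<in> V"
        using w sub unfolding V_def I by (auto simp: monoms_def)
      have "i \<in> mult_vars n L V ?t" if "count ?t i < count w i" for i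
      proof (rule top[OF finV V_monoms t])
        show "i \<in> {1..n}"
          using w count_less_in[OF that] by (auto simp: I monoms_def)
        then show "count ?t i = N"
          using that by (simp add: count_cube)
      qed (use V_bound in auto)
      then have "w \<in> inv_cone L V ?t"
        unfolding inv_cone_iff[OF sp] by auto
      then show "w \<in> (\<Union>u\<in>V. inv_cone L V u)"
        using t by blast
    qed
  qed
  have "completion_of n L U V"
    unfolding completion_of_def involutive_set_def
    using finV V_monoms UV coneV invV I_def by auto
  then show "finitely_generated n L U"
    unfolding finitely_generated_def using finV by blast
qed

section \<open>Thomas division\<close>

lemma mult_vars_thomas:
  assumes "finite U" "u \<in> U"
  shows "mult_vars n (thomas n) U u = {i \<in> {1..n}. \<forall>v\<in>U. count v i \<le> count u i}"
proof -
  have "count u i = Max ((\<lambda>v. count v i) ` U) \<longleftrightarrow> (\<forall>v\<in>U. count v i \<le> count u i)" for i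
    using assms Max_eq_iff[of "(\<lambda>v. count v i) ` U" "count u i"] by (auto simp: eq_commute)
  then show ?thesis
    by (simp add: thomas_def mult_vars_division_by)
qed

lemma spanned_thomas: "spanned_by_vars n (thomas n)"
  by (simp add: thomas_def spanned_division_by)

lemma involutive_thomas: "involutive_division n (thomas n)"
proof (rule involutive_divisionI[OF spanned_thomas])
  fix U u v
  assume U: "finite U" "U \<subseteq> monoms n" and uv: "u \<in> U" "v \<in> U"
  note M = mult_vars_thomas[OF U(1)]
  show False if "\<And>i. count u i < count v i \<Longrightarrow> i \<in> mult_vars n (thomas n) U u"
    "\<exists>i. count u i < count v i"
    using that uv by (fastforce simp: M)
  show "mult_vars n (thomas n) U v \<subseteq> mult_vars n (thomas n) U u"
    if "v \<in> inv_cone (thomas n) U u"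
  proof -
    have "\<not> count u i < count v i" for i
      using that uv unfolding inv_cone_iff[OF spanned_thomas] by (fastforce simp: M)
    then have "u = v"
      using that unfolding inv_cone_iff[OF spanned_thomas] subseteq_mset_def
      by (metis le_neq_implies_less multiset_eq_iff)
    then show ?thesis by simp
  qed
qed (auto simp: mult_vars_thomas finite_subset subsetD)

lemma continuous_thomas: "continuous_division n (thomas n)"
proof (rule continuous_if_increasing[OF involutive_thomas, of "\<lambda>u v. size u < size v"])
  fix U u v
  assume U: "finite U" "U \<subseteq> monoms n" and uv: "u \<in> U" "v \<in> U"
    and st: "inv_step n (thomas n) U u v"
  note M = mult_vars_thomas[OF U(1)]
  obtain j where j: "j \<in> {1..n}" "j \<notin> mult_vars n (thomas n) U u"
    "\<And>i. count v i \<le> count u i + (if i = j then 1 else 0)"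
    "\<And>i. count v i < count u i + (if i = j then 1 else 0) \<Longrightarrow> i \<in> mult_vars n (thomas n) U v"
    using inv_stepE[OF spanned_thomas st] by metis
  obtain x where x: "x \<in> U" "count u j < count x j"
    using j(1,2) uv by (auto simp: M not_le)
  (* If v were smaller than u x_j in x_i, its exponent there would be maximal in U; but u, or x if
     i = j, reaches the exponent of u x_j. *)
  have "count v i = count (u + {#j#}) i" for i
    using j(3,4)[of i] uv x by (force simp: M)
  then have "v = u + {#j#}"
    by (intro multiset_eqI)
  then show "size u < size v"
    by simp
qed (auto intro!: transpI asympI)

lemma constructive_thomas: "constructive_division n (thomas n)"
proof (rule constructive_if_nested[OF continuous_thomas])
  fix U t w
  assume U: "finite U" "U \<subseteq> monoms n" and t: "t \<in> U" and w: "w \<in> inv_cone (thomas n) U t"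
  have w': "t \<subseteq># w" "\<And>i. count t i < count w i \<Longrightarrow> i \<in> mult_vars n (thomas n) U t"
    using w unfolding inv_cone_iff[OF spanned_thomas] by auto
  have "mult_vars n (thomas n) (insert w U) w \<subseteq> mult_vars n (thomas n) U t"
  proof
    fix i assume i: "i \<in> mult_vars n (thomas n) (insert w U) w"
    show "i \<in> mult_vars n (thomas n) U t"
    proof (cases "count t i < count w i")
      case False
      then have "count w i = count t i"
        using count_le_if_subset[OF w'(1), of i] by simp
      then show ?thesis
        using i U t by (simp add: mult_vars_thomas)
    qed (rule w')
  qed
  then show "thomas n w (insert w U) \<subseteq> thomas n t U"
    by (auto simp: spannedD[OF spanned_thomas])
qed

lemma noetherian_thomas: "noetherian_division n (thomas n)"
  by (rule noetherian_if_top_multiplicative[OF involutive_thomas spanned_thomas])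
    (simp add: mult_vars_thomas)

section \<open>Janet division\<close>

definition lex_less :: "monom \<Rightarrow> monom \<Rightarrow> bool" where
  "lex_less u v \<longleftrightarrow> (\<exists>k. (\<forall>i<k. count u i = count v i) \<and> count u k < count v k)"

lemma lex_less_trans: "lex_less u v \<Longrightarrow> lex_less v w \<Longrightarrow> lex_less u w"
proof -
  assume "lex_less u v" "lex_less v w"
  then obtain k l where k: "\<forall>i<k. count u i = count v i" "count u k < count v k"
    and l: "\<forall>i<l. count v i = count w i" "count v l < count w l"
    by (auto simp: lex_less_def)
  show "lex_less u w"
    unfolding lex_less_def
    using k l by (intro exI[of _ "min k l"]) (cases k l rule: linorder_cases; auto)
qed

lemma not_lex_less_refl: "\<not> lex_less u u"
  by (simp add: lex_less_def)

lemma transp_lex_less: "transp lex_less"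
  by (rule transpI) (rule lex_less_trans)

lemma asymp_lex_less: "asymp lex_less"
  by (rule asympI) (metis lex_less_trans not_lex_less_refl)

lemma first_difference:
  assumes "(u :: monom) \<noteq> v"
  obtains k where "\<forall>i<k. count u i = count v i" "count u k \<noteq> count v k"
  using assms exists_least_iff[of "\<lambda>k. count u k \<noteq> count v k"] by (metis multiset_eqI)

text \<open>
  Every monomial has exponent 0 at the index 0, so the classes can be described by agreement on all
  smaller indices.
\<close>

lemma mult_vars_janet:
  assumes "finite U" "U \<subseteq> monoms n" "u \<in> U"
  shows "mult_vars n (janet n) U u =
    {i \<in> {1..n}. \<forall>v\<in>U. (\<forall>j<i. count v j = count u j) \<longrightarrow> count v i \<le> count u i}"
proof -
  have "(count u i = Max ((\<lambda>v. count v i) ` janet_class U (count u) (i - 1)))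
    = (\<forall>v\<in>U. (\<forall>j<i. count v j = count u j) \<longrightarrow> count v i \<le> count u i)"
    if "i \<in> {1..n}" for i
  proof -
    have 0: "count v 0 = 0" if "v \<in> U" for v
      using that assms(2) monoms_count[of v n 0] by (metis atLeastAtMost_iff gr0I not_one_le_zero subsetD)
    have range: "(\<forall>j\<in>{1..i - 1}. count v j = count u j) \<longleftrightarrow> (\<forall>j<i. count v j = count u j)"
      if "v \<in> U" for v
    proof -
      have "j < i \<longleftrightarrow> j = 0 \<or> j \<in> {1..i - 1}" for j
        using \<open>i \<in> {1..n}\<close> by auto
      then show ?thesis
        using 0[OF that] 0[OF assms(3)] by metis
    qed
    have cls: "janet_class U (count u) (i - 1) = {v \<in> U. \<forall>j<i. count v j = count u j}"
      using range by (auto simp: janet_class_def)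
    let ?A = "(\<lambda>v. count v i) ` {v \<in> U. \<forall>j<i. count v j = count u j}"
    have "finite ?A" "?A \<noteq> {}"
      using assms by auto
    then show ?thesis
      unfolding cls using Max_eq_iff[of ?A "count u i"] assms(3) by auto
  qed
  then show ?thesis
    unfolding janet_def mult_vars_division_by by auto
qed

lemma spanned_janet: "spanned_by_vars n (janet n)"
  by (simp add: janet_def spanned_division_by)

text \<open>
  At the first index where \<open>u\<close> and \<open>v\<close> differ they belong to the same class, and there the smaller
  exponent is not maximal. So the Janet cones of distinct elements of \<open>U\<close> never meet.
\<close>

lemma janet_cones_disjoint:
  assumes "finite U" "U \<subseteq> monoms n" "u \<in> U" "v \<in> U"
    and "\<And>i. count u i < count v i \<Longrightarrow> i \<in> mult_vars n (janet n) U u"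
    and "\<And>i. count v i < count u i \<Longrightarrow> i \<in> mult_vars n (janet n) U v"
  shows "u = v"
proof (rule ccontr)
  assume "u \<noteq> v"
  then obtain k where k: "\<forall>i<k. count u i = count v i" "count u k \<noteq> count v k"
    by (rule first_difference)
  then show False
    using assms(5,6)[of k] assms(3,4)
    by (auto simp: mult_vars_janet[OF assms(1,2)] neq_iff) force+
qed

lemma involutive_janet: "involutive_division n (janet n)"
proof (rule involutive_divisionI[OF spanned_janet])
  fix U u v
  assume U: "finite U" "U \<subseteq> monoms n" and uv: "u \<in> U" "v \<in> U"
  show False if "\<And>i. count u i < count v i \<Longrightarrow> i \<in> mult_vars n (janet n) U u"
    "\<And>i. count v i < count u i \<Longrightarrow> i \<in> mult_vars n (janet n) U v"
    "\<exists>i. count u i < count v i"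
    using janet_cones_disjoint[OF U uv that(1,2)] that(3) by auto
  show "mult_vars n (janet n) U v \<subseteq> mult_vars n (janet n) U u"
    if v: "v \<in> inv_cone (janet n) U u"
  proof -
    have "u = v"
      using v unfolding inv_cone_iff[OF spanned_janet]
      by (intro janet_cones_disjoint[OF U uv]) (auto dest: count_le_if_subset simp: not_le[symmetric])
    then show ?thesis by simp
  qed
next
  fix U V u
  assume U: "finite U" "U \<subseteq> monoms n" and V: "V \<subseteq> U" "u \<in> V"
  have "finite V" "V \<subseteq> monoms n" "u \<in> U"
    using U V by (auto intro: finite_subset)
  then show "mult_vars n (janet n) U u \<subseteq> mult_vars n (janet n) V u"
    using U V by (auto simp: mult_vars_janet)
qed

text \<open>
  An involutive divisor \<open>v\<close> of \<open>u x\<^sub>j\<close> cannot drop below it at an index up to \<open>j\<close>: at the first such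
  index, \<open>u\<close> or, at \<open>j\<close>, an element of its class with larger exponent witnesses that the variable is
  not multiplicative for \<open>v\<close>.
\<close>

lemma janet_step:
  assumes U: "finite U" "U \<subseteq> monoms n" and uv: "u \<in> U" "v \<in> U"
    and j: "j \<in> nonmult_vars n (janet n) U u"
    and v: "u + {#j#} \<in> inv_cone (janet n) U v"
  shows "(\<forall>i<j. count u i = count v i) \<and> count v j = count u j + 1"
proof -
  note M = mult_vars_janet[OF U]
  have div: "count v i \<le> count u i + (if i = j then 1 else 0)"
    and mult: "count v i < count u i + (if i = j then 1 else 0) \<Longrightarrow> i \<in> mult_vars n (janet n) U v" for i
    using v[unfolded inv_cone_iff[OF spanned_janet]] mset_subset_eq_count[of v "u + {#j#}" i]
    by (cases "i = j"; auto)+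
  have below: "count u i = count v i" if "i < j" for i
    using that
  proof (induction i rule: less_induct)
    case (less i)
    show ?case
      using div[of i] mult[of i] less uv by (force simp: M)
  qed
  obtain x where x: "x \<in> U" "\<forall>i<j. count x i = count u i" "count u j < count x j"
    using j uv by (auto simp: nonmult_vars_def M not_le)
  have "\<not> count v j < count u j + 1"
    using mult[of j] x uv below by (force simp: M)
  then show ?thesis
    using below div[of j] by auto
qed

lemma continuous_janet: "continuous_division n (janet n)"
proof (rule continuous_if_increasing[OF involutive_janet transp_lex_less asymp_lex_less])
  fix U u v
  assume U: "finite U" "U \<subseteq> monoms n" and uv: "u \<in> U" "v \<in> U"
    and "inv_step n (janet n) U u v"
  then obtain j where "j \<in> nonmult_vars n (janet n) U u" "u + {#j#} \<in> inv_cone (janet n) U v"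
    by (auto simp: inv_step_def inv_divides_def)
  from janet_step[OF U uv this] show "lex_less u v"
    unfolding lex_less_def by (intro exI[of _ j]) auto
qed

text \<open>
  Let \<open>w \<in> t L(t, U)\<close> be new, and let \<open>l\<close> be the first index where \<open>t\<close> and \<open>w\<close> differ. Then \<open>t\<close> has the
  largest exponent of \<open>x\<^sub>l\<close> in its class, and \<open>w\<close> a larger one. Among the divisors in \<open>U\<close> of
  \<open>u x\<^sub>i\<close> that agree with \<open>t\<close> up to \<open>l\<close>, let \<open>v\<close> be the lexicographically largest. It is not an
  involutive divisor, and a variable \<open>x\<^sub>k\<close> responsible for this has \<open>k > l\<close>: below \<open>l\<close> the classes and
  exponents of \<open>v\<close> are those of \<open>w\<close>, and at \<open>l\<close> those of \<open>t\<close>. As \<open>v x\<^sub>k\<close> still has the exponent of \<open>t\<close> at \<open>l\<close>, it is a proper divisor of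
  \<open>u x\<^sub>i\<close>, so by assumption it has an involutive divisor in \<open>U\<close>, which by \<open>janet_step\<close> is
  lexicographically larger than \<open>v\<close>.
\<close>

lemma constructive_janet: "constructive_division n (janet n)"
  unfolding constructive_division_def
proof (intro conjI continuous_janet allI impI ballI notI, elim conjE)
  fix U u i w
  let ?M = "mult_vars n (janet n)"
  assume U: "finite U" "U \<subseteq> monoms n" and u: "u \<in> U"
    and no: "\<not> (\<exists>t\<in>U. inv_divides (janet n) U t (u + {#i#}))"
    and smaller: "\<forall>v\<in>U. \<forall>j\<in>nonmult_vars n (janet n) U v.
      v + {#j#} \<subseteq># u + {#i#} \<and> v + {#j#} \<noteq> u + {#i#} \<longrightarrow>
      v + {#j#} \<in> (\<Union>t\<in>U. inv_cone (janet n) U t)"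
    and w: "w \<in> (\<Union>t\<in>U. inv_cone (janet n) U t)"
    and ui: "u + {#i#} \<in> inv_cone (janet n) (insert w U) w"
  define m where "m = u + {#i#}"
  obtain t where t: "t \<in> U" "w \<in> inv_cone (janet n) U t"
    using w by auto
  note tw = t(2)[unfolded inv_cone_iff[OF spanned_janet]]
  note wm = ui[folded m_def, unfolded inv_cone_iff[OF spanned_janet]]
  have "w \<in> monoms n"
    using inv_cone_monoms[OF spanned_janet _ t(2)] t(1) U(2) by blast
  then have U': "finite (insert w U)" "insert w U \<subseteq> monoms n"
    using U by auto
  have "w \<notin> U"
    using no ui by (auto simp: inv_divides_def insert_absorb)
  then have "t \<noteq> w"
    using t by auto
  then obtain l where l: "\<forall>i<l. count t i = count w i" "count t l \<noteq> count w l"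
    by (rule first_difference)
  then have tl: "count t l < count w l"
    using tw count_le_if_subset[of t w l] by auto
  have lM: "l \<in> ?M U t"
    using tw tl by auto
  define D where "D = {v \<in> U. v \<subseteq># m \<and> (\<forall>k\<le>l. count v k = count t k)}"
  have "t \<in> D"
    using t tw wm by (auto simp: D_def intro: subset_mset.trans)
  have "finite D"
    using U by (simp add: D_def)
  then obtain v where v: "v \<in> D" and max: "\<forall>x\<in>D. x \<noteq> v \<longrightarrow> \<not> lex_less v x"
    using Finite_Set.bex_max_element[of D lex_less] \<open>t \<in> D\<close> transp_lex_less asymp_lex_less
    by (metis asymp_on_subset empty_iff subset_UNIV transp_on_subset)
  have vD: "v \<in> U" "v \<subseteq># m" "\<And>k. k \<le> l \<Longrightarrow> count v k = count t k"
    using v by (auto simp: D_def)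
  obtain k where k: "count v k < count m k" "k \<notin> ?M U v"
    using no vD by (auto simp: inv_divides_def inv_cone_iff[OF spanned_janet] m_def)
  have "m \<in> monoms n"
    using inv_cone_monoms[OF spanned_janet \<open>w \<in> monoms n\<close> ui] by (simp add: m_def)
  then have kn: "k \<in> {1..n}"
    using k count_monoms_outside[of m n k] by (metis not_less_zero)
  have kl: "l < k"
  proof (rule ccontr)
    assume "\<not> l < k"
    then consider "k < l" | "k = l" by linarith
    then show False
    proof cases
      case 1
      then have eq: "count w k = count v k" "\<And>j. j \<le> k \<Longrightarrow> count w j = count v j"
        using l vD(3) by auto
      then have "k \<in> ?M (insert w U) w"
        using k wm by auto
      then have "k \<in> ?M U v"
        using eq vD(1) by (simp add: mult_vars_janet[OF U'] mult_vars_janet[OF U])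
      then show False using k by simp
    next
      case 2
      then have "k \<in> ?M U v"
        using lM t(1) vD by (simp add: mult_vars_janet[OF U])
      then show False using k by simp
    qed
  qed
  have kN: "k \<in> nonmult_vars n (janet n) U v"
    using k kn by (simp add: nonmult_vars_def)
  have div: "v + {#k#} \<subseteq># m"
    unfolding subseteq_mset_def using k(1) count_le_if_subset[OF vD(2)] by auto
  have "count (v + {#k#}) l < count m l"
    using kl vD(3)[of l] tl count_le_if_subset[of w m l] wm by auto
  then have "v + {#k#} \<noteq> m"
    by auto
  then obtain x where x: "x \<in> U" "v + {#k#} \<in> inv_cone (janet n) U x"
    using smaller vD(1) kN div unfolding m_def by blast
  note step = janet_step[OF U vD(1) x(1) kN x(2)]
  have "x \<in> D"
    unfolding D_def
  proof (intro CollectI conjI x(1))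
    show "x \<subseteq># m"
      using x(2) div by (auto simp: inv_cone_iff[OF spanned_janet] intro: subset_mset.trans)
    show "\<forall>k\<le>l. count x k = count t k"
      using step kl vD(3) by auto
  qed
  moreover have "lex_less v x"
    using step unfolding lex_less_def by (intro exI[of _ k]) auto
  ultimately show False
    using max by (metis not_lex_less_refl)
qed

lemma noetherian_janet: "noetherian_division n (janet n)"
  by (rule noetherian_if_top_multiplicative[OF involutive_janet spanned_janet])
    (simp add: mult_vars_janet)

section \<open>Divisions that do not depend on the monomial set\<close>

lemma mult_vars_pommaret:
  "mult_vars n (pommaret n) U u = {i \<in> {1..n}. \<forall>k\<in>#u. k \<le> i}"
proof -
  have "(u = {#} \<or> Max (set_mset u) \<le> i) \<longleftrightarrow> (\<forall>k\<in>#u. k \<le> i)" for i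
    by (cases "u = {#}") auto
  then show ?thesis
    unfolding pommaret_def mult_vars_division_by by auto
qed

lemma spanned_pommaret: "spanned_by_vars n (pommaret n)"
  by (simp add: pommaret_def spanned_division_by)

text \<open>
  The Pommaret division and Division II assign multiplicative variables to a monomial independently of
  the set, so their nestedness axiom holds with different sets on the two sides. This is what
  \<open>constructive_if_nested\<close> asks for.
\<close>

lemma pommaret_nested:
  assumes "v \<in> inv_cone (pommaret n) U u"
  shows "mult_vars n (pommaret n) V v \<subseteq> mult_vars n (pommaret n) U u"
  using assms by (auto simp: inv_cone_iff[OF spanned_pommaret] mult_vars_pommaret dest: mset_subset_eqD)

lemma involutive_pommaret: "involutive_division n (pommaret n)"
proof (rule involutive_divisionI[OF spanned_pommaret])
  fix U u v
  assume u: "\<And>i. count u i < count v i \<Longrightarrow> i \<in> mult_vars n (pommaret n) U u"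
    and v: "\<And>i. count v i < count u i \<Longrightarrow> i \<in> mult_vars n (pommaret n) U v"
    and ex: "\<exists>i. count u i < count v i" "\<exists>i. count v i < count u i"
  obtain i l where i: "count u i < count v i" and l: "count v l < count u l"
    using ex by auto
  have "l \<le> i"
    using u[OF i] count_less_in[OF l] by (auto simp: mult_vars_pommaret)
  moreover have "i \<le> l"
    using v[OF l] count_less_in[OF i] by (auto simp: mult_vars_pommaret)
  ultimately show False
    using i l by simp
qed (use pommaret_nested in \<open>auto simp: mult_vars_pommaret\<close>)

text \<open>
  A divisor of \<open>u x\<^sub>j\<close>, with \<open>j\<close> below the largest variable of \<open>u\<close>, contains no variable beyond that
  one, so a step can only enlarge the set \<open>M\<close> of multiplicative variables. If it does not change,
  all variables up to \<open>x\<^sub>j\<close> are non-multiplicative for \<open>v\<close> too; there \<open>v\<close> coincides with \<open>u x\<^sub>j\<close>.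
\<close>

lemma continuous_pommaret: "continuous_division n (pommaret n)"
proof -
  define M where "M u = {i \<in> {1..n}. \<forall>k\<in>#u. k \<le> i}" for u :: monom
  let ?r = "\<lambda>u v. M u \<subset> M v \<or> M u = M v \<and> lex_less u v"
  show ?thesis
  proof (rule continuous_if_increasing[OF involutive_pommaret, of ?r])
    show "transp ?r"
      by (rule transpI) (metis lex_less_trans psubset_trans)
    show "asymp ?r"
      by (rule asympI) (metis lex_less_trans not_lex_less_refl psubset_trans psubsetE subset_refl)
    fix U u v
    assume "inv_step n (pommaret n) U u v"
    then obtain j where j: "j \<in> {1..n}" "j \<notin> M u"
      and div: "\<And>i. count v i \<le> count u i + (if i = j then 1 else 0)"
      and mult: "\<And>i. count v i < count u i + (if i = j then 1 else 0) \<Longrightarrow> i \<in> M v"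
      by (rule inv_stepE[OF spanned_pommaret]) (auto simp: mult_vars_pommaret M_def)
    obtain k where k: "k \<in># u" "j < k"
      using j by (auto simp: M_def not_le)
    have "\<exists>l'\<in>#u. l \<le> l'" if "l \<in># v" for l
    proof (cases "l = j")
      case False
      then have "l \<in># u"
        using div[of l] that by (simp add: count_greater_zero_iff[symmetric] del: count_greater_zero_iff)
      then show ?thesis by blast
    qed (use k in \<open>auto intro: less_imp_le\<close>)
    then have sub: "M u \<subseteq> M v"
      unfolding M_def by fastforce
    show "?r u v"
    proof (cases "M u = M v")
      case True
      have "count v i = count u i" if "i < j" for i
      proof -
        have "i \<notin> M u"
          using k that unfolding M_def by fastforce
        then have "i \<notin> M v"
          using True by simp
        then show ?thesis
          using mult[of i] div[of i] that by force
      qed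
      moreover have "count u j < count v j"
        using mult[of j] j True by force
      ultimately show ?thesis
        using True unfolding lex_less_def by metis
    qed (use sub in auto)
  qed
qed

lemma constructive_pommaret: "constructive_division n (pommaret n)"
  using pommaret_nested
  by (intro constructive_if_nested[OF continuous_pommaret])
    (fastforce simp: spannedD[OF spanned_pommaret])

definition max_degree :: "nat \<Rightarrow> monom \<Rightarrow> nat" where
  "max_degree n u = Max (count u ` {1..n})"

lemma count_le_max_degree: "i \<in> {1..n} \<Longrightarrow> count u i \<le> max_degree n u"
  by (simp add: max_degree_def)

lemma max_degree_leI:
  "n \<ge> 1 \<Longrightarrow> (\<And>i. i \<in> {1..n} \<Longrightarrow> count u i \<le> m) \<Longrightarrow> max_degree n u \<le> m"
  by (simp add: max_degree_def)

lemma mult_vars_division_II: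
  "mult_vars n (division_II n) U u = {i \<in> {1..n}. count u i = max_degree n u}"
  unfolding division_II_def mult_vars_division_by by (simp add: max_degree_def)

lemma spanned_division_II: "spanned_by_vars n (division_II n)"
  by (simp add: division_II_def spanned_division_by)

lemma max_degree_mono:
  assumes "u \<subseteq># v" "n \<ge> 1"
  shows "max_degree n u \<le> max_degree n v"
  using assms by (meson count_le_if_subset count_le_max_degree le_trans max_degree_leI)

lemma division_II_nested:
  assumes v: "v \<in> inv_cone (division_II n) U u" and "n \<ge> 1"
  shows "mult_vars n (division_II n) V v \<subseteq> mult_vars n (division_II n) U u"
proof
  fix i assume i: "i \<in> mult_vars n (division_II n) V v"
  note v' = v[unfolded inv_cone_iff[OF spanned_division_II]]
  show "i \<in> mult_vars n (division_II n) U u"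
  proof (cases "count u i < count v i")
    case False
    then have "count u i = count v i"
      using v' count_le_if_subset[of u v i] by simp
    then show ?thesis
      using i max_degree_mono[of u v n] v' assms(2) count_le_max_degree[of i n u]
      by (simp add: mult_vars_division_II)
  qed (use v' in auto)
qed

lemma involutive_division_II:
  assumes "n \<ge> 1"
  shows "involutive_division n (division_II n)"
proof (rule involutive_divisionI[OF spanned_division_II])
  fix U u v
  assume uv: "U \<subseteq> monoms n" "u \<in> U" "v \<in> U"
    and u: "\<And>i. count u i < count v i \<Longrightarrow> i \<in> mult_vars n (division_II n) U u"
    and v: "\<And>i. count v i < count u i \<Longrightarrow> i \<in> mult_vars n (division_II n) U v"
    and ex: "\<exists>i. count u i < count v i" "\<exists>i. count v i < count u i"
  obtain i l where i: "count u i < count v i" and l: "count v l < count u l"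
    using ex by auto
  have "i \<in> {1..n}" "l \<in> {1..n}" "count u i = max_degree n u" "count v l = max_degree n v"
    using u[OF i] v[OF l] by (auto simp: mult_vars_division_II)
  then show False
    using i l count_le_max_degree[of i n v] count_le_max_degree[of l n u] by linarith
qed (use division_II_nested assms in \<open>auto simp: mult_vars_division_II\<close>)

text \<open>
  As \<open>x\<^sub>j\<close> does not have the largest exponent in \<open>u\<close>, the monomials \<open>u x\<^sub>j\<close> and \<open>u\<close> have the same
  largest exponent. An involutive divisor of \<open>u x\<^sub>j\<close> arises from it by truncating at some level: either the
  level lies below the largest exponent, or nothing is cut off and the degree grows.
\<close>

lemma continuous_division_II:
  assumes "n \<ge> 1"
  shows "continuous_division n (division_II n)"
proof -
  let ?r = "\<lambda>u v. max_degree n v < max_degree n u \<or> max_degree n v = max_degree n u \<and> size u < size v"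
  show ?thesis
  proof (rule continuous_if_increasing[OF involutive_division_II[OF assms], of ?r])
    fix U u v
    assume uv: "U \<subseteq> monoms n" "u \<in> U" "v \<in> U"
    assume "inv_step n (division_II n) U u v"
    then obtain j where j: "j \<in> {1..n}" "count u j < max_degree n u"
      and div: "\<And>i. count v i \<le> count u i + (if i = j then 1 else 0)"
      and mult: "\<And>i. count v i < count u i + (if i = j then 1 else 0) \<Longrightarrow> count v i = max_degree n v"
      by (rule inv_stepE[OF spanned_division_II])
        (force simp: mult_vars_division_II order_less_le count_le_max_degree)
    have le: "count u i + (if i = j then 1 else 0) \<le> max_degree n u" if "i \<in> {1..n}" for i
      using j count_le_max_degree[OF that, of u] by auto
    have "max_degree n v \<le> max_degree n u"
      using assms div le by (meson max_degree_leI order_trans)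
    moreover have "size u < size v" if eq: "max_degree n v = max_degree n u"
    proof -
      have "count v i = count (u + {#j#}) i" for i
      proof (cases "i \<in> {1..n}")
        case True
        then have "count v i = count u i + (if i = j then 1 else 0)"
          using div[of i] mult[of i] le[OF True] eq by (metis le_antisym not_le)
        then show ?thesis
          by simp
      next
        case False
        then have "count u i = 0" "count v i = 0" "i \<noteq> j"
          using uv monoms_count[of _ n i] j by blast+
        then show ?thesis by simp
      qed
      then have "v = u + {#j#}"
        by (intro multiset_eqI)
      then show ?thesis by simp
    qed
    ultimately show "?r u v"
      by linarith
  qed (auto intro!: transpI asympI)
qed

lemma constructive_division_II: "n \<ge> 1 \<Longrightarrow> constructive_division n (division_II n)"
  using division_II_nested
  by (intro constructive_if_nested[OF continuous_division_II])
    (fastforce simp: spannedD[OF spanned_division_II])+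

lemma noetherian_division_II:
  assumes "n \<ge> 1"
  shows "noetherian_division n (division_II n)"
proof (rule noetherian_if_top_multiplicative[OF involutive_division_II[OF assms] spanned_division_II])
  fix V u i N
  assume "i \<in> {1..n}" "count u i = N" "u \<in> V" "\<And>v k. v \<in> V \<Longrightarrow> count v k \<le> N"
  then have "max_degree n u = count u i"
    unfolding max_degree_def by (intro Max_eqI) auto
  then show "i \<in> mult_vars n (division_II n) V u"
    using \<open>i \<in> {1..n}\<close> by (simp add: mult_vars_division_II)
qed

section \<open>Division I\<close>

text \<open>The variables dividing \<open>lcm(u, v) / u\<close>.\<close>

definition excess :: "monom \<Rightarrow> monom \<Rightarrow> nat set" where
  "excess u v = {i. count u i < count v i}"

lemma excess_subset: "v \<in> monoms n \<Longrightarrow> excess u v \<subseteq> {1..n}"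
  by (auto simp: excess_def monoms_def dest!: count_less_in)

lemma finite_excess [simp]: "finite (excess u v)"
  by (rule finite_subset[of _ "set_mset v"]) (auto simp: excess_def intro: count_less_in)

text \<open>
  The exponents \<open>d\<^sub>j\<close> in the definition are determined by \<open>lcm(u, v)\<close>, so Division I only counts the
  variables in which \<open>v\<close> exceeds \<open>u\<close>.
\<close>

lemma div_I_nonmult_iff:
  assumes "U \<subseteq> monoms n" "u \<in> monoms n"
  shows "div_I_nonmult n U u i \<longleftrightarrow> (\<exists>v\<in>U. i \<in> excess u v \<and> card (excess u v) \<le> n div 2)"
proof
  assume "div_I_nonmult n U u i"
  then obtain v m S d where v: "v \<in> U" and m: "m \<le> n div 2" and S: "S \<subseteq> {1..n}" "card S = m"
    and d: "\<forall>j\<in>S. d j > 0"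
    and lcm: "(\<Sum>j\<in>S. replicate_mset (d j) j) + u = u \<union># v" and i: "i \<in> S"
    unfolding div_I_nonmult_def by blast
  have "finite S"
    using S finite_subset by blast
  have "(if k \<in> S then d k else 0) + count u k = max (count u k) (count v k)" for k
    using arg_cong[OF lcm, of "\<lambda>x. count x k"] \<open>finite S\<close> by (simp add: count_sum sum.delta)
  then have "k \<in> S \<longleftrightarrow> k \<in> excess u v" for k
    using d by (cases "k \<in> S") (force simp: excess_def max_def split: if_splits)+
  then have "S = excess u v"
    by blast
  then show "\<exists>v\<in>U. i \<in> excess u v \<and> card (excess u v) \<le> n div 2"
    using v i m S by auto
next
  assume "\<exists>v\<in>U. i \<in> excess u v \<and> card (excess u v) \<le> n div 2"
  then obtain v where v: "v \<in> U" "i \<in> excess u v" "card (excess u v) \<le> n div 2"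
    by blast
  let ?d = "\<lambda>j. count v j - count u j"
  have sum: "(\<Sum>j\<in>excess u v. replicate_mset (?d j) j) + u = u \<union># v"
  proof (rule multiset_eqI)
    fix k
    show "count ((\<Sum>j\<in>excess u v. replicate_mset (?d j) j) + u) k = count (u \<union># v) k"
      by (simp add: count_sum) (auto simp: excess_def)
  qed
  have card: "1 \<le> card (excess u v)"
    using v(2) by (metis One_nat_def Suc_leI card_gt_0_iff empty_iff finite_excess)
  have subset: "excess u v \<subseteq> {1..n}"
    using excess_subset v assms by blast
  have pos: "\<forall>j\<in>excess u v. ?d j > 0"
    by (auto simp: excess_def)
  show "div_I_nonmult n U u i"
    unfolding div_I_nonmult_def
    by (intro bexI[of _ v] exI[of _ "card (excess u v)"] exI[of _ "excess u v"] exI[of _ ?d]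
        conjI refl v card subset pos sum)
qed

lemma mult_vars_division_I:
  assumes "U \<subseteq> monoms n" "u \<in> monoms n"
  shows "mult_vars n (division_I n) U u =
    {i \<in> {1..n}. \<forall>v\<in>U. i \<in> excess u v \<longrightarrow> n div 2 < card (excess u v)}"
  unfolding division_I_def mult_vars_division_by div_I_nonmult_iff[OF assms] by (auto simp: not_le)

lemma spanned_division_I: "spanned_by_vars n (division_I n)"
  by (simp add: division_I_def spanned_division_by)

lemma card_excess_gt:
  assumes "U \<subseteq> monoms n" "u \<in> U" "v \<in> U" "i \<in> excess u v" "i \<in> mult_vars n (division_I n) U u"
  shows "n div 2 < card (excess u v)"
  using assms by (auto simp: mult_vars_division_I subsetD)

text \<open>
  This is where the bound \<open>[n/2]\<close> matters: of two monomials, at most one can exceed the other in more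
  than half of the variables.
\<close>

lemma card_excess_swap:
  assumes "u \<in> monoms n" "v \<in> monoms n" "n div 2 < card (excess u v)"
  shows "card (excess v u) \<le> n div 2"
proof -
  have "card (excess u v) + card (excess v u) = card (excess u v \<union> excess v u)"
    by (rule card_Un_disjoint[symmetric]) (simp_all, auto simp: excess_def)
  also have "\<dots> \<le> card {1..n}"
    using assms excess_subset by (intro card_mono) auto
  finally show ?thesis
    using assms(3) by simp
qed

text \<open>
  If at most half of the variables lie in \<open>excess u v\<close>, they are non-multiplicative for \<open>u\<close>. An involutive multiple \<open>w\<close>
  of \<open>u\<close> has the same exponents there, and at least those of \<open>u\<close> elsewhere.
\<close>

lemma excess_involutive_multiple:
  assumes "w \<in> inv_cone (division_I n) U u" "U \<subseteq> monoms n" "u \<in> U" "v \<in> U"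
    and "card (excess u v) \<le> n div 2"
  shows "excess w v = excess u v"
proof -
  note w = assms(1)[unfolded inv_cone_iff[OF spanned_division_I]]
  have le: "count u k \<le> count w k" for k
    using w by (simp add: count_le_if_subset)
  have eq: "count w k = count u k" if "k \<in> excess u v" for k
  proof (rule ccontr)
    assume "count w k \<noteq> count u k"
    then have "k \<in> mult_vars n (division_I n) U u"
      using w le[of k] by simp
    then show False
      using card_excess_gt[OF assms(2-4) that] assms(5) by simp
  qed
  show ?thesis
  proof (intro set_eqI iffI)
    fix k
    show "k \<in> excess u v" if "k \<in> excess w v"
      using that le[of k] by (simp add: excess_def)
    show "k \<in> excess w v" if "k \<in> excess u v"
      using that eq[OF that] by (simp add: excess_def)
  qed
qed

lemma division_I_nested:
  assumes w: "w \<in> inv_cone (division_I n) U u" and U: "U \<subseteq> monoms n" "u \<in> U"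
    and V: "U \<subseteq> V" "V \<subseteq> monoms n" "w \<in> monoms n"
  shows "mult_vars n (division_I n) V w \<subseteq> mult_vars n (division_I n) U u"
proof
  fix i assume i: "i \<in> mult_vars n (division_I n) V w"
  have "n div 2 < card (excess u v)" if v: "v \<in> U" "i \<in> excess u v" for v
  proof (rule ccontr)
    assume "\<not> n div 2 < card (excess u v)"
    then have "excess w v = excess u v"
      using excess_involutive_multiple[OF w U v(1)] by simp
    then show False
      using i v V \<open>\<not> _\<close> by (auto simp: mult_vars_division_I)
  qed
  moreover have "i \<in> {1..n}" "u \<in> monoms n"
    using i U mult_vars_subset[of n "division_I n" V w] by auto
  ultimately show "i \<in> mult_vars n (division_I n) U u"
    using mult_vars_division_I[OF U(1), of u] by blast
qed

lemma involutive_division_I: "involutive_division n (division_I n)"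
proof (rule involutive_divisionI[OF spanned_division_I])
  fix U u v
  assume U: "U \<subseteq> monoms n" and uv: "u \<in> U" "v \<in> U"
  show False if "\<And>i. count u i < count v i \<Longrightarrow> i \<in> mult_vars n (division_I n) U u"
    "\<And>i. count v i < count u i \<Longrightarrow> i \<in> mult_vars n (division_I n) U v"
    "\<exists>i. count u i < count v i" "\<exists>i. count v i < count u i"
  proof -
    have "n div 2 < card (excess u v)" "n div 2 < card (excess v u)"
      using that card_excess_gt[OF U uv] card_excess_gt[OF U uv(2,1)] by (auto simp: excess_def)
    then show False
      using card_excess_swap[of u n v] U uv by (auto simp: subsetD)
  qed
  show "mult_vars n (division_I n) U v \<subseteq> mult_vars n (division_I n) U u"
    if "v \<in> inv_cone (division_I n) U u"
    using division_I_nested[OF that U uv(1) _ U] U uv by auto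
next
  fix U V u
  assume "U \<subseteq> monoms n" "V \<subseteq> U" "u \<in> V"
  then have "u \<in> monoms n" "V \<subseteq> monoms n"
    by auto
  then show "mult_vars n (division_I n) U u \<subseteq> mult_vars n (division_I n) V u"
    using \<open>U \<subseteq> monoms n\<close> \<open>V \<subseteq> U\<close> by (auto simp: mult_vars_division_I)
qed

text \<open>
  The proof by contradiction follows a path from \<open>p\<close> back to its predecessor \<open>u\<close> in a minimal trap.
  The set \<open>T\<close> of variables lowered by the step from \<open>u\<close> to \<open>p\<close> is multiplicative for \<open>p\<close> and, being
  nonempty, contains more than half of the variables. The invariant along the path is that a
  monomial which exceeds \<open>p\<close> somewhere in \<open>T\<close> is at least \<open>p\<close> everywhere outside \<open>T\<close>.
\<close>

lemma continuous_division_I: "continuous_division n (division_I n)"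
proof (rule continuous_if_no_minimal_trap[OF involutive_division_I])
  fix U C
  let ?M = "mult_vars n (division_I n) U"
  assume U: "finite U" "U \<subseteq> monoms n" and C: "trap n (division_I n) U C"
    and min: "\<And>D. D \<subseteq> C \<Longrightarrow> trap n (division_I n) U D \<Longrightarrow> D = C"
  have CU: "C \<subseteq> U" and CM: "\<And>x. x \<in> C \<Longrightarrow> x \<in> monoms n"
    using C U by (auto simp: trap_def)
  have "finite C" "C \<noteq> {}"
    using C U by (auto simp: trap_def intro: finite_subset)
  then have "Max (size ` C) \<in> size ` C"
    by (intro Max_in) auto
  then obtain u where u: "u \<in> C" "Max (size ` C) = size u"
    by (rule imageE)
  have max: "size x \<le> size u" if "x \<in> C" for x
    using Max_ge[of "size ` C" "size x"] that \<open>finite C\<close> u(2) by auto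
  note u = u(1)
  obtain p where p: "p \<in> C" and step: "inv_step n (division_I n) U u p"
    using C u by (auto simp: trap_def)
  obtain j where j: "j \<in> {1..n}" "j \<notin> ?M u"
    and p_le: "\<And>i. count p i \<le> count u i + (if i = j then 1 else 0)"
    and p_mult: "\<And>i. count p i < count u i + (if i = j then 1 else 0) \<Longrightarrow> i \<in> ?M p"
    using inv_stepE[OF spanned_division_I step] by metis
  have "p \<noteq> u"
    using p_mult[of j] j by auto
  (* The variables lowered by the step from u to p. *)
  let ?T = "excess p u"
  have T_mult: "?T \<subseteq> ?M p"
    using p_mult by (auto simp: excess_def)
  (* Otherwise p would be an involutive divisor of u, which a minimal trap excludes. *)
  have pj: "count p j = count u j + 1"
  proof (rule ccontr)
    assume "count p j \<noteq> count u j + 1"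
    then have "count p i \<le> count u i" for i
      using p_le[of i] p_le[of j] by (cases "i = j") auto
    then have "u \<in> inv_cone (division_I n) U p"
      using T_mult by (auto simp: inv_cone_iff[OF spanned_division_I] subseteq_mset_def excess_def)
    then show False
      using minimal_trap_antichain[OF involutive_division_I U C min p u] \<open>p \<noteq> u\<close> by blast
  qed
  have "?T \<noteq> {}"
  proof
    assume "?T = {}"
    then have "u \<subseteq># p"
      by (auto simp: subseteq_mset_def excess_def not_less)
    then have "u \<subset># p"
      using \<open>p \<noteq> u\<close> by auto
    then show False
      using mset_subset_size max[OF p] by fastforce
  qed
  have reaches: "n div 2 < card (excess p x)" if "x \<in> C" "excess p x \<inter> ?T \<noteq> {}" for x
    using card_excess_gt[OF U(2), of p x] that p CU T_mult by blast
  have T_large: "n div 2 < card ?T"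
    using reaches[OF u] \<open>?T \<noteq> {}\<close> by auto
  have invariant: "x \<in> C \<and> (excess p x \<inter> ?T \<noteq> {} \<longrightarrow> (\<forall>i. i \<notin> ?T \<longrightarrow> count p i \<le> count x i))"
    if "(\<lambda>x y. y \<in> C \<and> inv_step n (division_I n) U x y)\<^sup>*\<^sup>* p x" for x
    using that
  proof (induction rule: rtranclp_induct)
    case base
    show ?case using p by (auto simp: excess_def)
  next
    case (step z q)
    then have z: "z \<in> C" "excess p z \<inter> ?T \<noteq> {} \<Longrightarrow> i \<notin> ?T \<Longrightarrow> count p i \<le> count z i"
      and q: "q \<in> C" for i
      by auto
    obtain l where q_le: "\<And>i. count q i \<le> count z i + (if i = l then 1 else 0)"
      and q_mult: "\<And>i. count q i < count z i + (if i = l then 1 else 0) \<Longrightarrow> i \<in> ?M q"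
      using inv_stepE[OF spanned_division_I] step.hyps(2) by metis
    have "count p i \<le> count q i" if touched: "excess p q \<inter> ?T \<noteq> {}" and i: "i \<notin> ?T" for i
    proof (cases "excess p z \<inter> ?T = {}")
      (* q is the first to exceed p in T, in the single variable x_l raised by the step. More than
         half of the variables are needed, and besides x_l only those outside T, which are fewer
         than half, are available: all of them must be used. *)
      case True
      have sub: "excess p q \<subseteq> insert l (excess p z)"
      proof
        fix k assume "k \<in> excess p q"
        then show "k \<in> insert l (excess p z)"
          using q_le[of k] by (cases "k = l") (auto simp: excess_def)
      qed
      have "l \<in> ?T"
        using sub touched True by auto
      show ?thesis
      proof (rule ccontr)
        assume less: "\<not> count p i \<le> count q i"
        then have i_n: "i \<in> {1..n}"
          using count_monoms_outside[OF CM[OF p], of i] by force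
        have "excess p q \<subseteq> insert l ({1..n} - ?T - {i})"
          using sub True excess_subset[OF CM[OF q], of p] less by (auto simp: excess_def)
        then have "card (excess p q) \<le> card (insert l ({1..n} - ?T - {i}))"
          by (intro card_mono) auto
        also have "\<dots> \<le> Suc (card ({1..n} - ?T - {i}))"
          by (rule card_insert_le_m1) auto
        also have "\<dots> = card ({1..n} - ?T)"
          using i i_n by (metis DiffI card_Suc_Diff1 finite_Diff finite_atLeastAtMost)
        also have "\<dots> = n - card ?T"
          using excess_subset[OF CM[OF u]] by (subst card_Diff_subset) auto
        finally show False
          using reaches[OF q touched] T_large by linarith
      qed
    next
      (* q exceeds p in more than half of the variables, so p exceeds q in at most half of them:
         these are non-multiplicative for q, hence not lowered by the step. *)
      case False
      have "card (excess q p) \<le> n div 2"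
        using card_excess_swap[OF CM[OF p] CM[OF q] reaches[OF q touched]] .
      show ?thesis
      proof (rule ccontr)
        assume less: "\<not> count p i \<le> count q i"
        then have "i \<notin> ?M q"
          using card_excess_gt[OF U(2), of q p i] p q CU \<open>card (excess q p) \<le> n div 2\<close>
          by (force simp: excess_def)
        then have "count z i \<le> count q i"
          using q_mult[of i] by (force split: if_splits)
        then show False
          using z(2)[OF False i] less by simp
      qed
    qed
    then show ?case using q by blast
  qed
  have "excess p u \<inter> ?T \<noteq> {}"
    using \<open>?T \<noteq> {}\<close> by simp
  moreover have "j \<notin> ?T"
    using pj by (simp add: excess_def)
  ultimately have "count p j \<le> count u j"
    using invariant[OF minimal_trap_connected[OF C min p u]] by blast
  then show False
    using pj by simp
qed

lemma constructive_division_I: "constructive_division n (division_I n)"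
proof (rule constructive_if_nested[OF continuous_division_I])
  fix U t w
  assume U: "finite U" "U \<subseteq> monoms n" and t: "t \<in> U" and w: "w \<in> inv_cone (division_I n) U t"
  have "w \<in> monoms n"
    using inv_cone_monoms[OF spanned_division_I _ w] t U by blast
  then show "division_I n w (insert w U) \<subseteq> division_I n t U"
    using division_I_nested[OF w U(2) t, of "insert w U"] U(2)
    by (simp add: subset_iff spannedD[OF spanned_division_I])
qed

lemma noetherian_division_I: "noetherian_division n (division_I n)"
proof (rule noetherian_if_top_multiplicative[OF involutive_division_I spanned_division_I])
  fix V u i N
  assume V: "V \<subseteq> monoms n" "u \<in> V" "i \<in> {1..n}" "count u i = N" "\<And>v k. v \<in> V \<Longrightarrow> count v k \<le> N"
  then have "i \<notin> excess u v" if "v \<in> V" for v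
    using that by (auto simp: excess_def not_less)
  then show "i \<in> mult_vars n (division_I n) V u"
    using V(1-3) by (simp add: mult_vars_division_I subsetD)
qed

theorem proposition3p9:
  fixes n :: nat
  assumes "n \<ge> 1"
  shows "(\<forall>L \<in> {thomas n, janet n, pommaret n, division_I n, division_II n}.
            continuous_division n L \<and> constructive_division n L) \<and>
         (\<forall>L \<in> {thomas n, janet n, division_I n, division_II n}. noetherian_division n L)"
  using assms continuous_thomas continuous_janet continuous_pommaret continuous_division_I
    continuous_division_II constructive_thomas constructive_janet constructive_pommaret
    constructive_division_I constructive_division_II noetherian_thomas noetherian_janet
    noetherian_division_I noetherian_division_II
  by auto

end
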